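(* $\theta(J(16,8)) = C_8 = 1430$ and $\theta(J(32,16)) = C_{16} = 35357670$, where $C_k=\frac{1}{k+1}\binom{2k}{k}$.
   Context: For integers $0<k<N$, the Johnson graph $J(N,k)$ has as vertices the $k$-element subsets of $\{1,\dots,N\}$, two being adjacent iff they share exactly $k-1$ elements. $\theta(G)$ denotes the smallest number of cliques of $G$ whose vertex sets together cover all vertices of $G$. *)

theory Defs
  imports Complex_Main "HOL-Library.Ramsey"
begin

text \<open>
  A finite simple graph is a pair \<open>(V, E)\<close> of a vertex set and a set of two-element edges
  \<open>{v, w}\<close>, the convention of the predicate \<^const>\<open>clique\<close>.
\<close>

definition johnson_graph :: "nat \<Rightarrow> nat \<Rightarrow> nat set set \<times> nat set set set" where
  "johnson_graph N k =
     (nsets {1..N} k,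
      {{A, B} | A B. A \<in> nsets {1..N} k \<and> B \<in> nsets {1..N} k \<and> A \<noteq> B \<and> card (A \<inter> B) = k - 1})"

text \<open>
  The predicate \<^const>\<open>clique\<close> does not relate the clique to the vertex set of the graph, so the
  inclusion in the vertex set is required separately.
\<close>

definition clique_cover :: "'a set \<times> 'a set set \<Rightarrow> 'a set set \<Rightarrow> bool" where
  "clique_cover G C \<longleftrightarrow> (\<forall>K\<in>C. K \<subseteq> fst G \<and> clique K (snd G)) \<and> \<Union>C = fst G"

definition clique_cover_number :: "'a set \<times> 'a set set \<Rightarrow> nat" where
  "clique_cover_number G = (LEAST n. \<exists>C. finite C \<and> card C = n \<and> clique_cover G C)"

text \<open>The singletons cover every finite graph, so the minimum is attained.\<close>

lemma clique_cover_number_attained: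
  assumes "finite (fst G)"
  shows "\<exists>C. finite C \<and> card C = clique_cover_number G \<and> clique_cover G C"
proof -
  have "finite ((\<lambda>v. {v}) ` fst G) \<and> clique_cover G ((\<lambda>v. {v}) ` fst G)"
    using assms by (auto simp: clique_cover_def clique_def)
  then have "\<exists>n C. finite C \<and> card C = n \<and> clique_cover G C"
    by blast
  then show ?thesis
    unfolding clique_cover_number_def by (rule LeastI_ex)
qed

definition catalan :: "nat \<Rightarrow> real" where
  "catalan k = 1 / (real k + 1) * real ((2 * k) choose k)"

end

theory Submission
  imports Defs
begin

text \<open>
  A clique of the Johnson graph consists of \<open>k\<close>-sets that contain a common \<open>(k-1)\<close>-set, or of
  \<open>k\<close>-sets that are contained in a common \<open>(k+1)\<close>-set, so for \<open>N = 2k\<close> it has at most \<open>k + 1\<close>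
  vertices and a cover needs at least \<open>C\<^sub>k\<close> cliques. When \<open>2k = 2\<^sup>m\<close>, identify the ground set
  with the group \<open>(\<int>/2)\<^sup>m\<close>. A \<open>k\<close>-set \<open>A\<close> with sum \<open>s\<close> determines the zero-sum set \<open>A - {s}\<close>
  (if \<open>s \<in> A\<close>) or \<open>A \<union> {s}\<close> (if \<open>s \<notin> A\<close>), and this is the only zero-sum set of size
  \<open>k - 1\<close> inside \<open>A\<close> or of size \<open>k + 1\<close> around \<open>A\<close>. The cliques of these zero-sum sets
  therefore partition the vertices into classes of size exactly \<open>k + 1\<close>.
\<close>

section \<open>Cliques of Johnson graphs\<close>

text \<open>For \<open>card Z = k - 1\<close> and \<open>card T = k + 1\<close>,
  \<open>star N Z\<close> and \<open>top_clique T\<close> are the two standard families of Johnson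
  graph cliques. Writing them as images of injective maps makes their sizes immediate.\<close>

definition star :: "nat \<Rightarrow> nat set \<Rightarrow> nat set set" where
  "star N Z = (\<lambda>x. insert x Z) ` ({1..N} - Z)"

definition top_clique :: "nat set \<Rightarrow> nat set set" where
  "top_clique T = (\<lambda>x. T - {x}) ` T"

lemma card_star:
  assumes "Z \<subseteq> {1..N}"
  shows "card (star N Z) = N - card Z"
proof -
  have "inj_on (\<lambda>x. insert x Z) ({1..N} - Z)"
    by (rule inj_onI) auto
  then show ?thesis
    using assms by (simp add: star_def card_image card_Diff_subset finite_subset)
qed

lemma card_top_clique: "card (top_clique T) = card T"
proof -
  have "inj_on (\<lambda>x. T - {x}) T"
    by (rule inj_onI) auto
  then show ?thesis
    by (simp add: top_clique_def card_image)
qed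

lemma card_johnson_vertices: "card (fst (johnson_graph N k)) = N choose k"
  by (simp add: johnson_graph_def)

lemma johnson_edge_iff:
  "{A, B} \<in> snd (johnson_graph N k) \<longleftrightarrow>
     A \<in> nsets {1..N} k \<and> B \<in> nsets {1..N} k \<and> A \<noteq> B \<and> card (A \<inter> B) = k - 1"
  by (auto simp: johnson_graph_def doubleton_eq_iff Int_commute)

lemma star_johnson_clique:
  assumes "Z \<subseteq> {1..N}" "Suc (card Z) = k"
  shows "star N Z \<subseteq> fst (johnson_graph N k) \<and> clique (star N Z) (snd (johnson_graph N k))"
proof -
  have fin: "finite Z"
    using assms(1) finite_subset by blast
  have vert: "A \<in> nsets {1..N} k" if "A \<in> star N Z" for A
    using that assms fin by (auto simp: star_def nsets_def)
  have "card (A \<inter> B) = k - 1" if AB: "A \<in> star N Z" "B \<in> star N Z" "A \<noteq> B" for A B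
  proof -
    have "A \<inter> B = Z"
      using AB by (auto simp: star_def)
    then show ?thesis
      using assms(2) by auto
  qed
  then have "clique (star N Z) (snd (johnson_graph N k))"
    using vert by (simp add: clique_def johnson_edge_iff)
  then show ?thesis
    using vert by (auto simp: johnson_graph_def)
qed

lemma top_johnson_clique:
  assumes "T \<subseteq> {1..N}" "card T = Suc k"
  shows "top_clique T \<subseteq> fst (johnson_graph N k) \<and> clique (top_clique T) (snd (johnson_graph N k))"
proof -
  have fin: "finite T"
    using assms(1) finite_subset by blast
  have vert: "A \<in> nsets {1..N} k" if "A \<in> top_clique T" for A
    using that assms fin by (auto simp: top_clique_def nsets_def)
  have "card (A \<inter> B) = k - 1" if AB: "A \<in> top_clique T" "B \<in> top_clique T" "A \<noteq> B" for A B
  proof -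
    obtain x y where xy: "A = T - {x}" "B = T - {y}" "x \<in> T" "y \<in> T" "x \<noteq> y"
      using AB by (auto simp: top_clique_def)
    then have "A \<inter> B = T - {x, y}"
      by auto
    then show ?thesis
      using xy assms(2) fin by (simp add: card_Diff_subset)
  qed
  then have "clique (top_clique T) (snd (johnson_graph N k))"
    using vert by (simp add: clique_def johnson_edge_iff)
  then show ?thesis
    using vert by (auto simp: johnson_graph_def)
qed

section \<open>Classification of cliques and the counting lower bound\<close>

lemma card_Suc_supersetE:
  assumes "finite A" "Z \<subseteq> A" "card A = Suc (card Z)"
  obtains a where "a \<notin> Z" "A = insert a Z"
proof -
  have "card (A - Z) = 1"
    using assms by (simp add: card_Diff_subset finite_subset)
  then obtain a where "A - Z = {a}"
    by (auto simp: card_1_singleton_iff)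
  then show thesis
    using that[of a] assms(2) by blast
qed

lemma adjacent_insertE:
  assumes "finite A" "finite B" "card A = Suc j" "card B = Suc j" "card (A \<inter> B) = j"
  obtains a b where "a \<notin> A \<inter> B" "A = insert a (A \<inter> B)" "b \<notin> A \<inter> B" "B = insert b (A \<inter> B)"
proof -
  obtain a where "a \<notin> A \<inter> B" "A = insert a (A \<inter> B)"
    using card_Suc_supersetE[of A "A \<inter> B"] assms by auto
  moreover obtain b where "b \<notin> A \<inter> B" "B = insert b (A \<inter> B)"
    using card_Suc_supersetE[of B "A \<inter> B"] assms by auto
  ultimately show thesis
    using that by blast
qed

text \<open>If every member contains \<open>A \<inter> B\<close>, the clique lies in a star. One
  member that misses a point of \<open>A \<inter> B\<close> is already forced to be
  \<open>A \<union> B\<close> without that point, and it then forces all other members into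
  \<open>A \<union> B\<close>.\<close>

lemma johnson_clique_cases:
  assumes V: "K \<subseteq> fst (johnson_graph N k)" and K: "clique K (snd (johnson_graph N k))"
    and AB: "A \<in> K" "B \<in> K" "A \<noteq> B"
  shows "K \<subseteq> star N (A \<inter> B) \<or> K \<subseteq> top_clique (A \<union> B)"
proof -
  have mem: "finite C \<and> C \<subseteq> {1..N} \<and> card C = k" if "C \<in> K" for C
    using V that by (auto simp: johnson_graph_def nsets_def)
  have adj: "card (C \<inter> D) = k - 1" if "C \<in> K" "D \<in> K" "C \<noteq> D" for C D
    using K that by (auto simp: clique_def johnson_edge_iff)
  have "k \<noteq> 0"
    using mem[OF AB(1)] mem[OF AB(2)] AB(3) by auto
  then obtain j where k: "k = Suc j"
    by (cases k) auto
  define Z where "Z = A \<inter> B"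
  have finZ: "finite Z" and cardZ: "card Z = j"
    using mem[OF AB(1)] adj[OF AB] k by (auto simp: Z_def)
  obtain a b where a: "a \<notin> Z" "A = insert a Z" and b: "b \<notin> Z" "B = insert b Z"
    using adjacent_insertE[of A B j] mem AB adj k unfolding Z_def by (metis diff_Suc_1)
  have ab: "a \<noteq> b"
    using a b AB(3) by auto
  have star_mem: "C \<in> star N Z" if C: "C \<in> K" "Z \<subseteq> C" for C
  proof -
    obtain c where "c \<notin> Z" "C = insert c Z"
      using card_Suc_supersetE[of C Z] mem C k cardZ by auto
    then show ?thesis
      using mem[OF C(1)] by (auto simp: star_def)
  qed
  have top_mem: "\<exists>z\<in>Z. D = (A \<union> B) - {z}" if D: "D \<in> K" "\<not> Z \<subseteq> D" for D
  proof -
    have ne: "D \<noteq> A" "D \<noteq> B"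
      using D(2) a b by auto
    obtain z where z: "z \<in> Z" "z \<notin> D"
      using D(2) by auto
    \<comment> \<open>The left side is contained in the right because \<open>D\<close> misses
      \<open>z\<close>, and both have \<open>j\<close> elements. Applied to \<open>A\<close> and
      \<open>B\<close>, this puts all of \<open>A \<union> B\<close> except \<open>z\<close> into
      \<open>D\<close>.\<close>
    have miss: "D \<inter> insert c Z = insert c Z - {z}"
      if c: "insert c Z \<in> K" "D \<noteq> insert c Z" "c \<notin> Z" for c
    proof (rule card_subset_eq)
      show "finite (insert c Z - {z})"
        using finZ by simp
      show "D \<inter> insert c Z \<subseteq> insert c Z - {z}"
        using z by auto
      show "card (D \<inter> insert c Z) = card (insert c Z - {z})"
        using adj[OF D(1) c(1,2)] finZ cardZ z c(3) k by auto
    qed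
    have "D \<inter> insert a Z = insert a Z - {z}" "D \<inter> insert b Z = insert b Z - {z}"
      using miss a b AB(1,2) ne by simp_all
    moreover have "z \<noteq> a" "z \<noteq> b"
      using a(1) b(1) z(1) by blast+
    ultimately have sub: "(A \<union> B) - {z} \<subseteq> D"
      unfolding a(2) b(2) by blast
    have "card (A \<union> B) = Suc (Suc j)"
      using a b ab finZ cardZ by simp
    then have "card ((A \<union> B) - {z}) = card D"
      using mem[OF D(1)] k z a by simp
    then have "(A \<union> B) - {z} = D"
      using sub mem[OF D(1)] by (intro card_subset_eq) auto
    then show ?thesis
      using z by auto
  qed
  show ?thesis
  proof (cases "\<forall>C\<in>K. Z \<subseteq> C")
    case True
    then show ?thesis
      using star_mem by (auto simp: Z_def)
  next
    case False
    then obtain D where D: "D \<in> K" "\<not> Z \<subseteq> D"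
      by auto
    then obtain z where z: "z \<in> Z" "D = (A \<union> B) - {z}"
      using top_mem by blast
    have "C \<in> top_clique (A \<union> B)" if C: "C \<in> K" for C
    proof (cases "Z \<subseteq> C")
      case True
      then obtain c where c: "c \<notin> Z" "C = insert c Z"
        using star_mem[OF C] by (auto simp: star_def)
      \<comment> \<open>A third point \<open>c\<close> would lie outside \<open>D\<close>, so
        \<open>C\<close> and \<open>D\<close> would share only \<open>j - 1\<close> points. Hence
        \<open>C\<close> is \<open>A\<close> or \<open>B\<close>.\<close>
      have "c = a \<or> c = b"
      proof (rule ccontr)
        assume "\<not> (c = a \<or> c = b)"
        then have "C \<inter> D = Z - {z}"
          using c z a b by auto
        moreover have "card (C \<inter> D) = j"
          using adj[OF C D(1)] True D(2) k by auto
        ultimately show False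
          using z cardZ finZ by (metis card_Diff1_less less_irrefl)
      qed
      then have "C = (A \<union> B) - {b} \<or> C = (A \<union> B) - {a}"
        using a b ab c by auto
      then show ?thesis
        using a b by (auto simp: top_clique_def)
    next
      case False
      then show ?thesis
        using top_mem[OF C] by (auto simp: top_clique_def Z_def)
    qed
    then show ?thesis
      by auto
  qed
qed

text \<open>A clique with two vertices lies in a star over a \<open>(k-1)\<close>-set or in the top
  clique of a \<open>(k+1)\<close>-set; the two arguments of \<open>max\<close> are the sizes of the
  latter and of the former.\<close>

lemma card_johnson_clique_le:
  assumes V: "K \<subseteq> fst (johnson_graph N k)" and K: "clique K (snd (johnson_graph N k))"
  shows "card K \<le> max (Suc k) (Suc (N - k))"
proof (cases "\<exists>A\<in>K. \<exists>B\<in>K. A \<noteq> B")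
  case False
  then have "card K \<le> 1"
    by (metis One_nat_def card_le_Suc0_iff_eq card.infinite zero_le)
  then show ?thesis
    by simp
next
  case True
  then obtain A B where AB: "A \<in> K" "B \<in> K" "A \<noteq> B"
    by auto
  have A: "finite A" "A \<subseteq> {1..N}" "card A = k" and B: "finite B" "B \<subseteq> {1..N}" "card B = k"
    using V AB by (auto simp: johnson_graph_def nsets_def)
  have int: "card (A \<inter> B) = k - 1"
    using K AB by (auto simp: clique_def johnson_edge_iff)
  have "k \<noteq> 0"
    using A B AB(3) by auto
  have "k \<le> N"
    using A card_mono[of "{1..N}" A] by simp
  have "card (A \<union> B) + card (A \<inter> B) = k + k"
    using A B card_Un_Int[of A B] by simp
  then have un: "card (A \<union> B) = Suc k"
    using int \<open>k \<noteq> 0\<close> by simp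
  have sub: "A \<inter> B \<subseteq> {1..N}"
    using A by auto
  from johnson_clique_cases[OF V K AB] show ?thesis
  proof
    assume "K \<subseteq> star N (A \<inter> B)"
    then have "card K \<le> card (star N (A \<inter> B))"
      by (intro card_mono) (auto simp: star_def)
    also have "\<dots> = Suc (N - k)"
      using card_star[OF sub] int \<open>k \<noteq> 0\<close> \<open>k \<le> N\<close> by simp
    finally show ?thesis
      by simp
  next
    assume "K \<subseteq> top_clique (A \<union> B)"
    then have "card K \<le> card (top_clique (A \<union> B))"
      using A B by (intro card_mono) (auto simp: top_clique_def)
    then show ?thesis
      by (simp add: card_top_clique un)
  qed
qed

lemma choose_le_johnson_clique_cover:
  assumes "finite C" "clique_cover (johnson_graph N k) C"
  shows "N choose k \<le> card C * max (Suc k) (Suc (N - k))"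
proof -
  have "N choose k = card (\<Union>C)"
    using assms(2) by (simp add: clique_cover_def card_johnson_vertices)
  also have "\<dots> \<le> (\<Sum>K\<in>C. card K)"
    by (rule card_Union_le_sum_card)
  also have "\<dots> \<le> card C * max (Suc k) (Suc (N - k))"
    using assms(2) card_johnson_clique_le
    by (intro sum_bounded_above[of C card, simplified]) (auto simp: clique_cover_def)
  finally show ?thesis .
qed

section \<open>Perfect covers from zero-sum sets\<close>

text \<open>Ordinary sums on \<open>nat\<close> use \<open>+\<close>; this instance provides finite
  sums for the group operation \<open>xor\<close>.\<close>

global_interpretation xor_set: comm_monoid_set "xor :: nat \<Rightarrow> nat \<Rightarrow> nat" 0
  defines xor_sum = xor_set.F
  by unfold_locales

text \<open>
  The point \<open>i\<close> of \<open>{1..2 ^ m}\<close> stands for the element \<open>i - 1\<close> of the group \<open>{0..<2 ^ m}\<close> under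
  exclusive or; \<open>point_sum\<close> is the point that stands for the sum of a set.
\<close>

definition point_sum :: "nat set \<Rightarrow> nat" where
  "point_sum A = Suc (xor_sum (\<lambda>i. i - 1) A)"

text \<open>\<open>take_bit m\<close> commutes with \<open>xor\<close> and fixes exactly the numbers
  below \<open>2 ^ m\<close>. This closure is where the power of two matters.\<close>

lemma xor_less_power_two:
  fixes a b :: nat
  assumes "a < 2 ^ m" "b < 2 ^ m"
  shows "xor a b < 2 ^ m"
proof -
  have "take_bit m (xor a b) = xor a b"
    using assms by (simp add: take_bit_nat_eq_self)
  then show ?thesis
    by (simp only: take_bit_nat_eq_self_iff)
qed

lemma point_sum_mem:
  assumes "A \<subseteq> {1..2 ^ m}"
  shows "point_sum A \<in> {1..2 ^ m}"
proof -
  have "finite A"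
    using assms finite_subset by blast
  then have "xor_sum (\<lambda>i. i - 1) A < 2 ^ m"
    using assms by (induction A rule: finite_induct) (auto intro!: xor_less_power_two)
  then show ?thesis
    by (simp add: point_sum_def)
qed

lemma point_sum_insert:
  assumes "finite Z" "x \<notin> Z"
  shows "point_sum (insert x Z) = Suc (xor (x - 1) (point_sum Z - 1))"
  using assms by (simp add: point_sum_def)

text \<open>Every group element is its own inverse. The point 1 stands for zero, so the value 1
  means zero-sum.\<close>

lemma point_sum_insert_self:
  assumes "finite A" "point_sum A \<notin> A"
  shows "point_sum (insert (point_sum A) A) = 1"
  using assms by (simp add: point_sum_insert)

text \<open>Truncated subtraction would send the points 0 and 1 to the same group element, hence
  \<open>x \<noteq> 0\<close>.\<close>

lemma point_sum_insert_zero: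
  assumes "finite Z" "x \<notin> Z" "x \<noteq> 0" "point_sum Z = 1"
  shows "point_sum (insert x Z) = x"
  using assms by (simp add: point_sum_insert)

lemma point_sum_remove:
  assumes "finite T" "x \<in> T"
  shows "point_sum (T - {x}) = Suc (xor (x - 1) (point_sum T - 1))"
proof -
  have "point_sum T = Suc (xor (x - 1) (point_sum (T - {x}) - 1))"
    using point_sum_insert[of "T - {x}" x] assms by (simp add: insert_absorb)
  \<comment> \<open>Adding \<open>x - 1\<close> on both sides cancels it, by
    self-inverseness.\<close>
  then have "xor (x - 1) (point_sum T - 1) = point_sum (T - {x}) - 1"
    by (simp flip: xor.assoc)
  then show ?thesis
    by (simp add: point_sum_def)
qed

text \<open>Indexing by a vertex rather than by the zero-sum set lets one function produce both
  kinds of clique, as the classes of a partition of the vertices.\<close>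

definition zero_sum_clique :: "nat \<Rightarrow> nat set \<Rightarrow> nat set set" where
  "zero_sum_clique N A =
     (if point_sum A \<in> A then star N (A - {point_sum A})
      else top_clique (insert (point_sum A) A))"

lemma zero_sum_clique_self:
  assumes "A \<subseteq> {1..2 ^ m}"
  shows "A \<in> zero_sum_clique (2 ^ m) A"
  using point_sum_mem[OF assms]
  by (auto simp: zero_sum_clique_def star_def top_clique_def insert_absorb
      intro!: image_eqI[where x = "point_sum A"])

text \<open>The point added to a zero-sum set, or removed from one, is the sum of the resulting set.
  So each member of a class recovers the same zero-sum set, and classes that meet are equal.\<close>

lemma zero_sum_clique_eq:
  assumes A: "A \<subseteq> {1..N}" and B: "B \<in> zero_sum_clique N A"
  shows "zero_sum_clique N B = zero_sum_clique N A"
proof -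
  have fin: "finite A"
    using A finite_subset by blast
  show ?thesis
  proof (cases "point_sum A \<in> A")
    case True
    define Z where "Z = A - {point_sum A}"
    have Z: "finite Z" "point_sum Z = 1"
      using fin True by (auto simp: Z_def point_sum_remove)
    have clA: "zero_sum_clique N A = star N Z"
      using True by (simp add: zero_sum_clique_def Z_def)
    then obtain x where x: "x \<notin> Z" "x \<noteq> 0" "B = insert x Z"
      using B by (auto simp: star_def)
    then have "point_sum B = x"
      using Z point_sum_insert_zero by simp
    then show ?thesis
      using x clA by (simp add: zero_sum_clique_def)
  next
    case False
    define T where "T = insert (point_sum A) A"
    have T: "finite T" "point_sum T = 1"
      using fin False point_sum_insert_self by (auto simp: T_def)
    \<comment> \<open>Guarantees \<open>Suc (x - 1) = x\<close> for the removed point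
      \<open>x\<close>.\<close>
    have "0 \<notin> T"
      using A by (auto simp: T_def point_sum_def)
    have clA: "zero_sum_clique N A = top_clique T"
      using False by (simp add: zero_sum_clique_def T_def)
    then obtain x where x: "x \<in> T" "B = T - {x}"
      using B by (auto simp: top_clique_def)
    then have "point_sum B = x"
      using T \<open>0 \<notin> T\<close> by (cases x) (auto simp: point_sum_remove)
    then have "zero_sum_clique N B = top_clique T"
      using x by (simp add: zero_sum_clique_def insert_absorb)
    then show ?thesis
      using clA by simp
  qed
qed

lemma zero_sum_clique_is_clique:
  assumes A: "A \<in> nsets {1..2 ^ m} k"
  shows "zero_sum_clique (2 ^ m) A \<subseteq> fst (johnson_graph (2 ^ m) k) \<and>
    clique (zero_sum_clique (2 ^ m) A) (snd (johnson_graph (2 ^ m) k))"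
proof -
  have A': "A \<subseteq> {1..2 ^ m}" "finite A" "card A = k"
    using A by (auto simp: nsets_def)
  \<comment> \<open>Keeps the enlarged set inside the ground set in the top clique case.\<close>
  note p = point_sum_mem[OF A'(1)]
  show ?thesis
  proof (cases "point_sum A \<in> A")
    case True
    then have "Suc (card (A - {point_sum A})) = k"
      using A' by (metis card_Suc_Diff1)
    then show ?thesis
      using True A' star_johnson_clique[of "A - {point_sum A}" "2 ^ m" k]
      by (auto simp: zero_sum_clique_def)
  next
    case False
    then have "card (insert (point_sum A) A) = Suc k"
      using A' by simp
    then show ?thesis
      using False A' p top_johnson_clique[of "insert (point_sum A) A" "2 ^ m" k]
      by (auto simp: zero_sum_clique_def)
  qed
qed

text \<open>With \<open>N = 2 * k\<close> the star has \<open>2 * k - (k - 1)\<close> members, as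
  many as the top clique.\<close>

lemma card_zero_sum_clique:
  assumes "A \<in> nsets {1..2 * k} k"
  shows "card (zero_sum_clique (2 * k) A) = Suc k"
proof -
  have A: "A \<subseteq> {1..2 * k}" "finite A" "card A = k"
    using assms by (auto simp: nsets_def)
  show ?thesis
  proof (cases "point_sum A \<in> A")
    case True
    then have "Suc (card (A - {point_sum A})) = k"
      using A by (metis card_Suc_Diff1)
    moreover have "A - {point_sum A} \<subseteq> {1..2 * k}"
      using A by auto
    ultimately show ?thesis
      using True card_star by (simp add: zero_sum_clique_def)
  next
    case False
    then show ?thesis
      using A by (simp add: zero_sum_clique_def card_top_clique)
  qed
qed

text \<open>Every vertex lies in its own class, and the distinct classes are disjoint cliques of
  size \<open>k + 1\<close>, so counting vertices gives the equation.\<close>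

lemma perfect_johnson_clique_cover:
  assumes "2 * k = 2 ^ m"
  shows "\<exists>C. finite C \<and> clique_cover (johnson_graph (2 * k) k) C \<and> Suc k * card C = 2 * k choose k"
proof -
  let ?V = "nsets {1..2 * k} k"
  have V: "fst (johnson_graph (2 * k) k) = ?V" "finite ?V"
    by (simp_all add: johnson_graph_def finite_imp_finite_nsets)
  have sub: "A \<subseteq> {1..2 * k}" if "A \<in> ?V" for A
    using that by (auto simp: nsets_def)
  define C where "C = zero_sum_clique (2 * k) ` ?V"
  have fin: "finite C"
    using V by (simp add: C_def)
  have cl: "K \<subseteq> ?V \<and> clique K (snd (johnson_graph (2 * k) k))" if "K \<in> C" for K
    using that zero_sum_clique_is_clique[of _ m k] assms V(1) unfolding C_def by fastforce
  have "A \<in> \<Union>C" if "A \<in> ?V" for A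
    using that zero_sum_clique_self[of A m] sub[OF that] assms unfolding C_def by auto
  then have U: "\<Union>C = ?V"
    using cl by blast
  have "Suc k * card C = card (\<Union>C)"
  proof (rule card_partition)
    show "finite C" "finite (\<Union>C)"
      using fin U V by simp_all
    show "card K = Suc k" if "K \<in> C" for K
      using that card_zero_sum_clique by (auto simp: C_def)
    have eq: "zero_sum_clique (2 * k) B = K" if "K \<in> C" "B \<in> K" for K B
      using that zero_sum_clique_eq[OF sub] by (auto simp: C_def)
    show "K \<inter> L = {}" if "K \<in> C" "L \<in> C" "K \<noteq> L" for K L
    proof (rule ccontr)
      assume "K \<inter> L \<noteq> {}"
      then obtain B where "B \<in> K" "B \<in> L"
        by auto
      then show False
        using eq[of K B] eq[of L B] that by simp
    qed
  qed
  then show ?thesis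
    using fin cl U V by (intro exI[of _ C]) (simp add: clique_cover_def)
qed

section \<open>The clique cover number when the ground set has power-of-two size\<close>

lemma clique_cover_number_johnson_power_two:
  assumes "2 * k = 2 ^ m"
  shows "real (clique_cover_number (johnson_graph (2 * k) k)) = catalan k"
proof -
  let ?G = "johnson_graph (2 * k) k"
  obtain C where C: "finite C" "clique_cover ?G C" "Suc k * card C = 2 * k choose k"
    using perfect_johnson_clique_cover[OF assms] by auto
  have "clique_cover_number ?G = card C"
    unfolding clique_cover_number_def
  proof (rule Least_equality)
    show "\<exists>D. finite D \<and> card D = card C \<and> clique_cover ?G D"
      using C by blast
    fix n
    assume "\<exists>D. finite D \<and> card D = n \<and> clique_cover ?G D"
    \<comment> \<open>For \<open>N = 2 * k\<close> both arguments of \<open>max\<close> in the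
      counting bound equal \<open>Suc k\<close>.\<close>
    then have "Suc k * card C \<le> n * Suc k"
      using choose_le_johnson_clique_cover[of _ "2 * k" k] C(3) by auto
    then show "card C \<le> n"
      by (metis Suc_mult_le_cancel1 mult.commute)
  qed
  moreover have "real (Suc k) * real (card C) = real (2 * k choose k)"
    by (simp only: C(3) flip: of_nat_mult)
  ultimately show ?thesis
    by (simp add: catalan_def field_simps)
qed

theorem theorem4p12:
  shows "(real (clique_cover_number (johnson_graph 16 8)) = catalan 8 \<and> catalan 8 = 1430) \<and>
    (real (clique_cover_number (johnson_graph 32 16)) = catalan 16 \<and> catalan 16 = 35357670)"
proof (intro conjI)
  show "real (clique_cover_number (johnson_graph 16 8)) = catalan 8"
    using clique_cover_number_johnson_power_two[of 8 4] by simp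
  show "real (clique_cover_number (johnson_graph 32 16)) = catalan 16"
    using clique_cover_number_johnson_power_two[of 16 5] by simp
  \<comment> \<open>Dividing these by 9 and 17 gives the two Catalan numbers.\<close>
  have "16 choose 8 = (12870 :: nat)" "32 choose 16 = (601080390 :: nat)"
    by (simp_all add: binomial_fact' fact_numeral)
  then show "catalan 8 = 1430" "catalan 16 = 35357670"
    by (simp_all add: catalan_def)
qed

end
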